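(* Every extension $L$ of $\mathbf{IL}^-$ satisfies $\ell$UFP: for any propositional variables $p,q$ and any formula $A(p)$ which is left-modalized in $p$, $$L \vdash \boxdot(p \leftrightarrow A(p)) \land \boxdot(q \leftrightarrow A(q)) \to (p \leftrightarrow q).$$
   Context: Formulas are generated by $A ::= \bot \mid p \mid A \to A \mid \Box A \mid A \rhd A$, where $p$ ranges over a countably infinite set of propositional variables. The symbols $\neg,\land,\lor,\leftrightarrow,\top,\Diamond$ (with $\Diamond A := \neg\Box\neg A$) are the usual abbreviations, and $\boxdot A := A \land \Box A$. $\neg,\Box,\Diamond,\boxdot$ bind most strongly. $v(A)$ is the set of propositional variables contained in $A$. For a formula $A(p)$, $A(B)$ denotes the result of substituting $B$ for all occurrences of $p$ in $A(p)$. The logic $\mathbf{IL}^-$ has as axioms all instances of: $\mathbf{L1}$: all tautologies in this language; $\mathbf{L2}$: $\Box(A\to B)\to(\Box A\to\Box B)$; $\mathbf{L3}$: $\Box(\Box A\to A)\to\Box A$; $\mathbf{J3}$: $((A\rhd C)\land(B\rhd C))\to((A\lor B)\rhd C)$; $\mathbf{J6}$: $\Box A\leftrightarrow((\neg A)\rhd\bot)$. Its inference rules are Modus Ponens, Necessitation (from $A$ infer $\Box A$), $\mathbf{R1}$ (from $A\to B$ infer $(C\rhd A)\to(C\rhd B)$) and $\mathbf{R2}$ (from $A\to B$ infer $(B\rhd C)\to(A\rhd C)$). $L \vdash A$ means that $A$ is a theorem of $L$. $L$ is an extension of $L'$ if every theorem of $L'$ is a theorem of $L$. A formula $A$ is modalized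 in $p$ if every occurrence of $p$ in $A$ is in the scope of some modal operator $\Box$ or $\rhd$. A formula $A$ is left-modalized in $p$ if $A$ is modalized in $p$ and $p\notin v(C)$ for any subformula $B\rhd C$ of $A$. *)

theory Defs
  imports Main
begin

text \<open>The countably infinite set of propositional variables is represented by \<open>nat\<close>.\<close>

type_synonym pvar = nat

datatype fm =
    Bot (\<open>\<^bold>\<bottom>\<close>)
  | Var pvar
  | Imp fm fm (infixr \<open>\<^bold>\<rightarrow>\<close> 55)
  | Box fm (\<open>\<^bold>\<box> _\<close> [80] 80)
  | Rhd fm fm (infix \<open>\<^bold>\<rhd>\<close> 60)

abbreviation Neg :: "fm \<Rightarrow> fm" (\<open>\<^bold>\<not> _\<close> [80] 80) where
  "\<^bold>\<not> A \<equiv> A \<^bold>\<rightarrow> \<^bold>\<bottom>"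

abbreviation Conj :: "fm \<Rightarrow> fm \<Rightarrow> fm" (infixr \<open>\<^bold>\<and>\<close> 70) where
  "A \<^bold>\<and> B \<equiv> \<^bold>\<not> (A \<^bold>\<rightarrow> \<^bold>\<not> B)"

abbreviation Disj :: "fm \<Rightarrow> fm \<Rightarrow> fm" (infixr \<open>\<^bold>\<or>\<close> 65) where
  "A \<^bold>\<or> B \<equiv> \<^bold>\<not> A \<^bold>\<rightarrow> B"

abbreviation Iff :: "fm \<Rightarrow> fm \<Rightarrow> fm" (infix \<open>\<^bold>\<leftrightarrow>\<close> 50) where
  "A \<^bold>\<leftrightarrow> B \<equiv> (A \<^bold>\<rightarrow> B) \<^bold>\<and> (B \<^bold>\<rightarrow> A)"

abbreviation Boxdot :: "fm \<Rightarrow> fm" (\<open>\<^bold>\<odot> _\<close> [80] 80) where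
  "\<^bold>\<odot> A \<equiv> A \<^bold>\<and> \<^bold>\<box> A"

primrec vars :: "fm \<Rightarrow> pvar set" where
  "vars \<^bold>\<bottom> = {}"
| "vars (Var p) = {p}"
| "vars (A \<^bold>\<rightarrow> B) = vars A \<union> vars B"
| "vars (\<^bold>\<box> A) = vars A"
| "vars (A \<^bold>\<rhd> B) = vars A \<union> vars B"

primrec subformulas :: "fm \<Rightarrow> fm set" where
  "subformulas \<^bold>\<bottom> = {\<^bold>\<bottom>}"
| "subformulas (Var p) = {Var p}"
| "subformulas (A \<^bold>\<rightarrow> B) = {A \<^bold>\<rightarrow> B} \<union> subformulas A \<union> subformulas B"
| "subformulas (\<^bold>\<box> A) = {\<^bold>\<box> A} \<union> subformulas A"
| "subformulas (A \<^bold>\<rhd> B) = {A \<^bold>\<rhd> B} \<union> subformulas A \<union> subformulas B"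

text \<open>\<open>subst p B A\<close> is \<open>A(B)\<close> for the formula \<open>A = A(p)\<close>.\<close>

primrec subst :: "pvar \<Rightarrow> fm \<Rightarrow> fm \<Rightarrow> fm" where
  "subst p B \<^bold>\<bottom> = \<^bold>\<bottom>"
| "subst p B (Var r) = (if r = p then B else Var r)"
| "subst p B (A1 \<^bold>\<rightarrow> A2) = subst p B A1 \<^bold>\<rightarrow> subst p B A2"
| "subst p B (\<^bold>\<box> A) = \<^bold>\<box> (subst p B A)"
| "subst p B (A1 \<^bold>\<rhd> A2) = subst p B A1 \<^bold>\<rhd> subst p B A2"

text \<open>Tautologies of the full language are instances of classical propositional tautologies:
  \<open>v\<close> assigns truth values independently to variables and to formulas whose main connective
  is modal, the latter being treated as atoms.\<close>

primrec prop_eval :: "(fm \<Rightarrow> bool) \<Rightarrow> fm \<Rightarrow> bool" where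
  "prop_eval v \<^bold>\<bottom> = False"
| "prop_eval v (Var p) = v (Var p)"
| "prop_eval v (A \<^bold>\<rightarrow> B) = (prop_eval v A \<longrightarrow> prop_eval v B)"
| "prop_eval v (\<^bold>\<box> A) = v (\<^bold>\<box> A)"
| "prop_eval v (A \<^bold>\<rhd> B) = v (A \<^bold>\<rhd> B)"

definition tautology :: "fm \<Rightarrow> bool" where
  "tautology A \<longleftrightarrow> (\<forall>v. prop_eval v A)"

text \<open>A logic is identified with its set of theorems.\<close>

type_synonym logic = "fm set"

abbreviation provable :: "logic \<Rightarrow> fm \<Rightarrow> bool" (infix \<open>\<^bold>\<turnstile>\<close> 45) where
  "L \<^bold>\<turnstile> A \<equiv> A \<in> L"

inductive_set IL_minus :: logic where
  L1: "tautology A \<Longrightarrow> A \<in> IL_minus"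
| L2: "\<^bold>\<box> (A \<^bold>\<rightarrow> B) \<^bold>\<rightarrow> (\<^bold>\<box> A \<^bold>\<rightarrow> \<^bold>\<box> B) \<in> IL_minus"
| L3: "\<^bold>\<box> (\<^bold>\<box> A \<^bold>\<rightarrow> A) \<^bold>\<rightarrow> \<^bold>\<box> A \<in> IL_minus"
| J3: "((A \<^bold>\<rhd> C) \<^bold>\<and> (B \<^bold>\<rhd> C)) \<^bold>\<rightarrow> ((A \<^bold>\<or> B) \<^bold>\<rhd> C) \<in> IL_minus"
| J6: "(\<^bold>\<box> A \<^bold>\<leftrightarrow> ((\<^bold>\<not> A) \<^bold>\<rhd> \<^bold>\<bottom>)) \<in> IL_minus"
| MP: "A \<^bold>\<rightarrow> B \<in> IL_minus \<Longrightarrow> A \<in> IL_minus \<Longrightarrow> B \<in> IL_minus"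
| Nec: "A \<in> IL_minus \<Longrightarrow> \<^bold>\<box> A \<in> IL_minus"
| R1: "A \<^bold>\<rightarrow> B \<in> IL_minus \<Longrightarrow> (C \<^bold>\<rhd> A) \<^bold>\<rightarrow> (C \<^bold>\<rhd> B) \<in> IL_minus"
| R2: "A \<^bold>\<rightarrow> B \<in> IL_minus \<Longrightarrow> (B \<^bold>\<rhd> C) \<^bold>\<rightarrow> (A \<^bold>\<rhd> C) \<in> IL_minus"

text \<open>As is usual, being an extension is only inclusion of theorems; the larger logic need not be
  closed under any particular rules.\<close>

definition extension_of :: "logic \<Rightarrow> logic \<Rightarrow> bool" where
  "extension_of L L' \<longleftrightarrow> (\<forall>A. L' \<^bold>\<turnstile> A \<longrightarrow> L \<^bold>\<turnstile> A)"

text \<open>The recursion stops at the modal operators, so \<open>modalized p A\<close> says that no occurrence of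
  \<open>p\<close> in \<open>A\<close> lies outside the scope of all of them.\<close>

primrec modalized :: "pvar \<Rightarrow> fm \<Rightarrow> bool" where
  "modalized p \<^bold>\<bottom> \<longleftrightarrow> True"
| "modalized p (Var r) \<longleftrightarrow> r \<noteq> p"
| "modalized p (A \<^bold>\<rightarrow> B) \<longleftrightarrow> modalized p A \<and> modalized p B"
| "modalized p (\<^bold>\<box> A) \<longleftrightarrow> True"
| "modalized p (A \<^bold>\<rhd> B) \<longleftrightarrow> True"

definition left_modalized :: "pvar \<Rightarrow> fm \<Rightarrow> bool" where
  "left_modalized p A \<longleftrightarrow>
     modalized p A \<and> (\<forall>B C. B \<^bold>\<rhd> C \<in> subformulas A \<longrightarrow> p \<notin> vars C)"

text \<open>\<open>A(p)\<close> is \<open>A\<close> itself. It may contain \<open>q\<close> and other variables besides \<open>p\<close>.\<close>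

definition lUFP :: "logic \<Rightarrow> bool" where
  "lUFP L \<longleftrightarrow>
     (\<forall>p q A. left_modalized p A \<longrightarrow>
        L \<^bold>\<turnstile> (\<^bold>\<odot> (Var p \<^bold>\<leftrightarrow> A) \<^bold>\<and> \<^bold>\<odot> (Var q \<^bold>\<leftrightarrow> subst p (Var q) A))
            \<^bold>\<rightarrow> (Var p \<^bold>\<leftrightarrow> Var q))"

end

theory Submission
  imports Defs
begin

text \<open>
  Formulas that are equivalent under \<open>\<^bold>\<box>\<close> may be exchanged in the left argument of \<open>\<^bold>\<rhd>\<close>:
  \<open>\<^bold>\<box> (A \<^bold>\<rightarrow> B)\<close> yields \<open>(A \<^bold>\<and> \<^bold>\<not> B) \<^bold>\<rhd> \<^bold>\<bottom>\<close> by J6, hence \<open>(A \<^bold>\<and> \<^bold>\<not> B) \<^bold>\<rhd> C\<close> by R1, and J3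
  joins this with \<open>B \<^bold>\<rhd> C\<close> to give \<open>A \<^bold>\<rhd> C\<close>. Consequently \<open>\<^bold>\<box> (p \<^bold>\<leftrightarrow> q)\<close> implies \<open>A(p) \<^bold>\<leftrightarrow> A(q)\<close>
  for left-modalized \<open>A\<close>. The fixed point hypothesis \<open>X\<close> thus implies
  \<open>\<^bold>\<box> (p \<^bold>\<leftrightarrow> q) \<^bold>\<rightarrow> (p \<^bold>\<leftrightarrow> q)\<close>, and since \<open>X\<close> implies \<open>\<^bold>\<box> X\<close>, Loeb's axiom finishes the argument.
\<close>

lemma taut_consequence1:
  assumes "IL_minus \<^bold>\<turnstile> A" "tautology (A \<^bold>\<rightarrow> B)"
  shows "IL_minus \<^bold>\<turnstile> B"
  by (rule IL_minus.MP[OF IL_minus.L1[OF assms(2)] assms(1)])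

lemma taut_consequence2:
  assumes "IL_minus \<^bold>\<turnstile> A" "IL_minus \<^bold>\<turnstile> B" "tautology (A \<^bold>\<rightarrow> B \<^bold>\<rightarrow> C)"
  shows "IL_minus \<^bold>\<turnstile> C"
  by (rule IL_minus.MP[OF IL_minus.MP[OF IL_minus.L1[OF assms(3)] assms(1)] assms(2)])

lemma taut_consequence3:
  assumes "IL_minus \<^bold>\<turnstile> A" "IL_minus \<^bold>\<turnstile> B" "IL_minus \<^bold>\<turnstile> C" "tautology (A \<^bold>\<rightarrow> B \<^bold>\<rightarrow> C \<^bold>\<rightarrow> D)"
  shows "IL_minus \<^bold>\<turnstile> D"
  by (rule IL_minus.MP[OF IL_minus.MP[OF IL_minus.MP[OF IL_minus.L1[OF assms(4)] assms(1)] assms(2)] assms(3)])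

lemma imp_trans:
  assumes "IL_minus \<^bold>\<turnstile> A \<^bold>\<rightarrow> B" "IL_minus \<^bold>\<turnstile> B \<^bold>\<rightarrow> C"
  shows "IL_minus \<^bold>\<turnstile> A \<^bold>\<rightarrow> C"
  using assms by (rule taut_consequence2) (simp add: tautology_def)

lemma Box_mono:
  assumes "IL_minus \<^bold>\<turnstile> A \<^bold>\<rightarrow> B"
  shows "IL_minus \<^bold>\<turnstile> \<^bold>\<box> A \<^bold>\<rightarrow> \<^bold>\<box> B"
  using IL_minus.L2 IL_minus.Nec[OF assms] by (rule IL_minus.MP)

lemma Box_Conj: "IL_minus \<^bold>\<turnstile> \<^bold>\<box> A \<^bold>\<rightarrow> \<^bold>\<box> B \<^bold>\<rightarrow> \<^bold>\<box> (A \<^bold>\<and> B)"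
proof -
  have "IL_minus \<^bold>\<turnstile> \<^bold>\<box> A \<^bold>\<rightarrow> \<^bold>\<box> (B \<^bold>\<rightarrow> A \<^bold>\<and> B)"
    by (rule Box_mono[OF IL_minus.L1]) (simp add: tautology_def)
  then show ?thesis
    using IL_minus.L2 by (rule imp_trans)
qed

text \<open>Transitivity follows from Loeb's axiom applied to \<open>\<^bold>\<odot> A\<close>.\<close>

lemma Box_Box: "IL_minus \<^bold>\<turnstile> \<^bold>\<box> A \<^bold>\<rightarrow> \<^bold>\<box> \<^bold>\<box> A"
proof -
  have "IL_minus \<^bold>\<turnstile> \<^bold>\<box> \<^bold>\<odot> A \<^bold>\<rightarrow> \<^bold>\<box> A"
    by (rule Box_mono[OF IL_minus.L1]) (simp add: tautology_def)
  then have "IL_minus \<^bold>\<turnstile> A \<^bold>\<rightarrow> (\<^bold>\<box> \<^bold>\<odot> A \<^bold>\<rightarrow> \<^bold>\<odot> A)"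
    by (rule taut_consequence1) (simp add: tautology_def)
  then have "IL_minus \<^bold>\<turnstile> \<^bold>\<box> A \<^bold>\<rightarrow> \<^bold>\<box> \<^bold>\<odot> A"
    by (rule Box_mono[THEN imp_trans, OF _ IL_minus.L3])
  moreover have "IL_minus \<^bold>\<turnstile> \<^bold>\<box> \<^bold>\<odot> A \<^bold>\<rightarrow> \<^bold>\<box> \<^bold>\<box> A"
    by (rule Box_mono[OF IL_minus.L1]) (simp add: tautology_def)
  ultimately show ?thesis
    by (rule imp_trans)
qed

lemma Box_Boxdot: "IL_minus \<^bold>\<turnstile> \<^bold>\<box> A \<^bold>\<rightarrow> \<^bold>\<box> \<^bold>\<odot> A"
  using Box_Box[of A] Box_Conj[of A "\<^bold>\<box> A"] by (rule taut_consequence2) (simp add: tautology_def)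

text \<open>By transitivity a boxed assumption is available inside a box both plainly and boxed.
  This lets facts about \<open>Boxdot\<close> pass under a modal operator.\<close>

lemma Box_mono_Boxdot:
  assumes "IL_minus \<^bold>\<turnstile> \<^bold>\<odot> A \<^bold>\<rightarrow> B"
  shows "IL_minus \<^bold>\<turnstile> \<^bold>\<box> A \<^bold>\<rightarrow> \<^bold>\<box> B"
  using Box_Boxdot Box_mono[OF assms] by (rule imp_trans)

lemma Boxdot_weaken:
  assumes "IL_minus \<^bold>\<turnstile> \<^bold>\<box> A \<^bold>\<rightarrow> B"
  shows "IL_minus \<^bold>\<turnstile> \<^bold>\<odot> A \<^bold>\<rightarrow> B"
  using assms by (rule taut_consequence1) (simp add: tautology_def)

lemma Box_imp_Rhd_left: "IL_minus \<^bold>\<turnstile> \<^bold>\<box> (A \<^bold>\<rightarrow> B) \<^bold>\<rightarrow> (B \<^bold>\<rhd> C) \<^bold>\<rightarrow> (A \<^bold>\<rhd> C)"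
proof -
  have "IL_minus \<^bold>\<turnstile> \<^bold>\<box> (A \<^bold>\<rightarrow> B) \<^bold>\<rightarrow> (\<^bold>\<not> (A \<^bold>\<rightarrow> B) \<^bold>\<rhd> \<^bold>\<bottom>)"
    using IL_minus.J6[of "A \<^bold>\<rightarrow> B"] by (rule taut_consequence1) (simp add: tautology_def)
  moreover have "IL_minus \<^bold>\<turnstile> (\<^bold>\<not> (A \<^bold>\<rightarrow> B) \<^bold>\<rhd> \<^bold>\<bottom>) \<^bold>\<rightarrow> (\<^bold>\<not> (A \<^bold>\<rightarrow> B) \<^bold>\<rhd> C)"
    by (rule IL_minus.R1[OF IL_minus.L1]) (simp add: tautology_def)
  ultimately have *: "IL_minus \<^bold>\<turnstile> \<^bold>\<box> (A \<^bold>\<rightarrow> B) \<^bold>\<rightarrow> (\<^bold>\<not> (A \<^bold>\<rightarrow> B) \<^bold>\<rhd> C)"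
    by (rule imp_trans)
  \<comment> \<open>Case split on \<open>B\<close>: if \<open>A\<close> holds, then either
    \<open>B\<close> holds or \<open>A\<close> and \<open>Neg B\<close> do. J3 treats these two
    disjuncts separately.\<close>
  have "IL_minus \<^bold>\<turnstile> ((\<^bold>\<not> (A \<^bold>\<rightarrow> B) \<^bold>\<or> B) \<^bold>\<rhd> C) \<^bold>\<rightarrow> (A \<^bold>\<rhd> C)"
    by (rule IL_minus.R2[OF IL_minus.L1]) (simp add: tautology_def)
  with * IL_minus.J3[of "\<^bold>\<not> (A \<^bold>\<rightarrow> B)" C B] show ?thesis
    by (rule taut_consequence3) (simp add: tautology_def)
qed

lemma Box_Iff_imps:
  shows "IL_minus \<^bold>\<turnstile> \<^bold>\<box> (A \<^bold>\<leftrightarrow> B) \<^bold>\<rightarrow> \<^bold>\<box> (A \<^bold>\<rightarrow> B)"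
    and "IL_minus \<^bold>\<turnstile> \<^bold>\<box> (A \<^bold>\<leftrightarrow> B) \<^bold>\<rightarrow> \<^bold>\<box> (B \<^bold>\<rightarrow> A)"
  by (rule Box_mono[OF IL_minus.L1]; simp add: tautology_def)+

lemma Box_cong: "IL_minus \<^bold>\<turnstile> \<^bold>\<box> (A \<^bold>\<leftrightarrow> B) \<^bold>\<rightarrow> (\<^bold>\<box> A \<^bold>\<leftrightarrow> \<^bold>\<box> B)"
  using Box_Iff_imps(1)[of A B, THEN imp_trans, OF IL_minus.L2]
    Box_Iff_imps(2)[of A B, THEN imp_trans, OF IL_minus.L2]
  by (rule taut_consequence2) (unfold tautology_def prop_eval.simps, blast)

lemma Rhd_left_cong: "IL_minus \<^bold>\<turnstile> \<^bold>\<box> (A \<^bold>\<leftrightarrow> B) \<^bold>\<rightarrow> ((A \<^bold>\<rhd> C) \<^bold>\<leftrightarrow> (B \<^bold>\<rhd> C))"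
  using Box_Iff_imps(1)[of A B, THEN imp_trans, OF Box_imp_Rhd_left[of _ _ C]]
    Box_Iff_imps(2)[of A B, THEN imp_trans, OF Box_imp_Rhd_left[of _ _ C]]
  by (rule taut_consequence2) (unfold tautology_def prop_eval.simps, blast)

lemma subst_fresh: "p \<notin> vars A \<Longrightarrow> subst p B A = A"
  by (induction A) auto

lemma Imp_cong:
  assumes "IL_minus \<^bold>\<turnstile> X \<^bold>\<rightarrow> (A \<^bold>\<leftrightarrow> A')" "IL_minus \<^bold>\<turnstile> X \<^bold>\<rightarrow> (B \<^bold>\<leftrightarrow> B')"
  shows "IL_minus \<^bold>\<turnstile> X \<^bold>\<rightarrow> ((A \<^bold>\<rightarrow> B) \<^bold>\<leftrightarrow> (A' \<^bold>\<rightarrow> B'))"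
  using assms by (rule taut_consequence2) (unfold tautology_def prop_eval.simps, blast)

text \<open>Here \<open>p\<close> may also occur outside all modal operators: the plain conjunct of
  \<open>Boxdot\<close> serves such occurrences, the boxed one those below a modal operator. Right
  arguments of \<open>Rhd\<close> are fixed by the substitution, so congruence on the left
  suffices.\<close>

lemma Boxdot_subst:
  assumes "\<And>B C. B \<^bold>\<rhd> C \<in> subformulas A \<Longrightarrow> p \<notin> vars C"
  shows "IL_minus \<^bold>\<turnstile> \<^bold>\<odot> (Var p \<^bold>\<leftrightarrow> D) \<^bold>\<rightarrow> (A \<^bold>\<leftrightarrow> subst p D A)"
  using assms
proof (induction A)
  case (Imp A B)
  then have "IL_minus \<^bold>\<turnstile> \<^bold>\<odot> (Var p \<^bold>\<leftrightarrow> D) \<^bold>\<rightarrow> (A \<^bold>\<leftrightarrow> subst p D A)"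
    and "IL_minus \<^bold>\<turnstile> \<^bold>\<odot> (Var p \<^bold>\<leftrightarrow> D) \<^bold>\<rightarrow> (B \<^bold>\<leftrightarrow> subst p D B)" by auto
  then show ?case
    by (simp only: subst.simps Imp_cong)
next
  case (Box A)
  then have "IL_minus \<^bold>\<turnstile> \<^bold>\<odot> (Var p \<^bold>\<leftrightarrow> D) \<^bold>\<rightarrow> (A \<^bold>\<leftrightarrow> subst p D A)" by auto
  then have "IL_minus \<^bold>\<turnstile> \<^bold>\<box> (Var p \<^bold>\<leftrightarrow> D) \<^bold>\<rightarrow> (\<^bold>\<box> A \<^bold>\<leftrightarrow> \<^bold>\<box> (subst p D A))"
    by (rule Box_mono_Boxdot[THEN imp_trans, OF _ Box_cong])
  then show ?case
    unfolding subst.simps by (rule Boxdot_weaken)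
next
  case (Rhd A C)
  then have "IL_minus \<^bold>\<turnstile> \<^bold>\<odot> (Var p \<^bold>\<leftrightarrow> D) \<^bold>\<rightarrow> (A \<^bold>\<leftrightarrow> subst p D A)" by auto
  then have "IL_minus \<^bold>\<turnstile> \<^bold>\<box> (Var p \<^bold>\<leftrightarrow> D) \<^bold>\<rightarrow> ((A \<^bold>\<rhd> C) \<^bold>\<leftrightarrow> (subst p D A \<^bold>\<rhd> C))"
    by (rule Box_mono_Boxdot[THEN imp_trans, OF _ Rhd_left_cong])
  then have "IL_minus \<^bold>\<turnstile> \<^bold>\<odot> (Var p \<^bold>\<leftrightarrow> D) \<^bold>\<rightarrow> ((A \<^bold>\<rhd> C) \<^bold>\<leftrightarrow> (subst p D A \<^bold>\<rhd> C))"
    by (rule Boxdot_weaken)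
  moreover have "subst p D C = C"
    using Rhd.prems[of A C] by (simp add: subst_fresh)
  ultimately show ?case
    by simp
qed (rule IL_minus.L1, simp add: tautology_def)+

text \<open>With every \<open>p\<close> below a modal operator, the boxed equivalence alone
  suffices. The argument of such an operator need not be modalized itself, so
  \<open>Boxdot_subst\<close> replaces the induction hypothesis there.\<close>

lemma Box_subst:
  assumes "left_modalized p A"
  shows "IL_minus \<^bold>\<turnstile> \<^bold>\<box> (Var p \<^bold>\<leftrightarrow> D) \<^bold>\<rightarrow> (A \<^bold>\<leftrightarrow> subst p D A)"
  using assms
proof (induction A)
  case (Imp A B)
  then have "IL_minus \<^bold>\<turnstile> \<^bold>\<box> (Var p \<^bold>\<leftrightarrow> D) \<^bold>\<rightarrow> (A \<^bold>\<leftrightarrow> subst p D A)"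
    and "IL_minus \<^bold>\<turnstile> \<^bold>\<box> (Var p \<^bold>\<leftrightarrow> D) \<^bold>\<rightarrow> (B \<^bold>\<leftrightarrow> subst p D B)"
    by (auto simp: left_modalized_def)
  then show ?case
    by (simp only: subst.simps Imp_cong)
next
  case (Box A)
  then have "IL_minus \<^bold>\<turnstile> \<^bold>\<odot> (Var p \<^bold>\<leftrightarrow> D) \<^bold>\<rightarrow> (A \<^bold>\<leftrightarrow> subst p D A)"
    by (auto simp: left_modalized_def intro!: Boxdot_subst)
  then show ?case
    unfolding subst.simps by (rule Box_mono_Boxdot[THEN imp_trans, OF _ Box_cong])
next
  case (Rhd A C)
  then have "IL_minus \<^bold>\<turnstile> \<^bold>\<odot> (Var p \<^bold>\<leftrightarrow> D) \<^bold>\<rightarrow> (A \<^bold>\<leftrightarrow> subst p D A)"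
    by (auto simp: left_modalized_def intro!: Boxdot_subst)
  moreover have "subst p D C = C"
    using Rhd.prems by (simp add: left_modalized_def subst_fresh)
  ultimately show ?case
    by (simp only: subst.simps Box_mono_Boxdot[THEN imp_trans, OF _ Rhd_left_cong])
\<comment> \<open>A variable that is modalized in \<open>p\<close> differs from \<open>p\<close>, so
  substitution leaves it unchanged.\<close>
qed (rule IL_minus.L1, simp add: tautology_def left_modalized_def)+

text \<open>Loeb's rule relative to \<open>X\<close>: boxing the assumption and applying L3 gives
  \<open>Box A\<close> from \<open>Box X\<close>, and the assumption itself then turns
  \<open>Box A\<close> into \<open>A\<close>.\<close>

lemma Boxdot_Loeb:
  assumes "IL_minus \<^bold>\<turnstile> \<^bold>\<odot> X \<^bold>\<rightarrow> (\<^bold>\<box> A \<^bold>\<rightarrow> A)"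
  shows "IL_minus \<^bold>\<turnstile> \<^bold>\<odot> X \<^bold>\<rightarrow> A"
proof -
  have "IL_minus \<^bold>\<turnstile> \<^bold>\<box> X \<^bold>\<rightarrow> \<^bold>\<box> A"
    using Box_mono_Boxdot[OF assms] IL_minus.L3 by (rule imp_trans)
  with assms show ?thesis
    by (rule taut_consequence2) (unfold tautology_def prop_eval.simps, blast)
qed

lemma left_modalized_unique_fixed_point:
  assumes "left_modalized p A"
  shows "IL_minus \<^bold>\<turnstile> (\<^bold>\<odot> (Var p \<^bold>\<leftrightarrow> A) \<^bold>\<and> \<^bold>\<odot> (D \<^bold>\<leftrightarrow> subst p D A)) \<^bold>\<rightarrow> (Var p \<^bold>\<leftrightarrow> D)"
proof -
  let ?F = "Var p \<^bold>\<leftrightarrow> A" and ?G = "D \<^bold>\<leftrightarrow> subst p D A"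
  \<comment> \<open>Under the boxed equivalence of \<open>Var p\<close> and \<open>D\<close>,
    \<open>Box_subst\<close> links \<open>A\<close> to \<open>subst p D A\<close>; the plain parts
    of \<open>?F\<close> and \<open>?G\<close> complete the chain from \<open>Var p\<close> to
    \<open>D\<close>.\<close>
  have "IL_minus \<^bold>\<turnstile> \<^bold>\<odot> (?F \<^bold>\<and> ?G) \<^bold>\<rightarrow> (\<^bold>\<box> (Var p \<^bold>\<leftrightarrow> D) \<^bold>\<rightarrow> (Var p \<^bold>\<leftrightarrow> D))"
    using Box_subst[OF assms, of D] by (rule taut_consequence1) (unfold tautology_def prop_eval.simps, blast)
  then have "IL_minus \<^bold>\<turnstile> \<^bold>\<odot> (?F \<^bold>\<and> ?G) \<^bold>\<rightarrow> (Var p \<^bold>\<leftrightarrow> D)"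
    by (rule Boxdot_Loeb)
  \<comment> \<open>Loeb's argument needs one boxed formula, whereas the hypotheses are boxed
    separately; \<open>Box_Conj\<close> merges them.\<close>
  with Box_Conj[of ?F ?G] show ?thesis
    by (rule taut_consequence2) (unfold tautology_def prop_eval.simps, blast)
qed

theorem theorem3p9:
  fixes L :: logic
  assumes "extension_of L IL_minus"
  shows "lUFP L"
  \<comment> \<open>The derivation lies entirely in \<open>IL_minus\<close>, so inclusion of
    theorems carries the case \<open>D = Var q\<close> over to \<open>L\<close>.\<close>
  using assms left_modalized_unique_fixed_point by (simp add: extension_of_def lUFP_def)

end
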